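(* Let $A$ be a non-zero complex $m\times n$ matrix. Then $$\frac{\|A\|}{32\sqrt{2}\,(\log h(A)+4)} \le \|A\|_P \le \|A\|.$$
   Context: For a complex $m\times n$ matrix $A$: $\|A\|$ is the operator norm induced by the Euclidean norm; $\|A\|_1$ is the largest absolute column sum; $\|A\|_\infty$ is the largest absolute row sum. The height of a non-zero $A$ is $h(A):=\sqrt{\|A\|_1\|A\|_\infty}/\|A\|$. The discrete Rayleigh norm is $\|A\|_P:=\max \frac{|\xi^tA\eta|}{\|\xi\|\|\eta\|}$, the maximum over all non-zero $\xi\in\{0,1\}^m$ and non-zero $\eta\in\{0,1\}^n$, where $\xi^t$ is the transpose and $\|\cdot\|$ is the Euclidean norm. $\log$ denotes the natural logarithm. *)

theory Defs
  imports "HOL-Analysis.Analysis"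
begin

definition op_norm :: "complex ^ 'n ^ 'm \<Rightarrow> real" where
  "op_norm A = onorm ((*v) A)"

definition col_norm :: "complex ^ 'n ^ 'm \<Rightarrow> real" where
  "col_norm A = (MAX j. \<Sum>i\<in>UNIV. cmod (A $ i $ j))"

definition row_norm :: "complex ^ 'n ^ 'm \<Rightarrow> real" where
  "row_norm A = (MAX i. \<Sum>j\<in>UNIV. cmod (A $ i $ j))"

definition height :: "complex ^ 'n ^ 'm \<Rightarrow> real" where
  "height A = sqrt (col_norm A * row_norm A) / op_norm A"

definition zero_one_vectors :: "(complex ^ 'n) set" where
  "zero_one_vectors = {v. v \<noteq> 0 \<and> (\<forall>i. v $ i \<in> {0, 1})}"

(* scalar_product is bilinear, without conjugation, so the numerator is the
   modulus of the product of the row vector of xi with A and eta. *)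
definition rayleigh_norm :: "complex ^ 'n ^ 'm \<Rightarrow> real" where
  "rayleigh_norm A =
     Max {cmod (scalar_product \<xi> (A *v \<eta>)) / (norm \<xi> * norm \<eta>) | \<xi> \<eta>.
            \<xi> \<in> zero_one_vectors \<and> \<eta> \<in> zero_one_vectors}"

(* The maximum in rayleigh_norm is over a finite non-empty set. *)
lemma finite_zero_one_vectors: "finite (zero_one_vectors :: (complex ^ 'n) set)"
proof (rule finite_subset)
  show "(zero_one_vectors :: (complex ^ 'n) set) \<subseteq> range (\<lambda>S. \<chi> i. if i \<in> S then 1 else 0)"
  proof
    fix v :: "complex ^ 'n" assume "v \<in> zero_one_vectors"
    hence "v = (\<chi> i. if i \<in> {i. v $ i = 1} then 1 else 0)"
      by (auto simp: zero_one_vectors_def vec_eq_iff)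
    thus "v \<in> range (\<lambda>S. \<chi> i. if i \<in> S then 1 else 0)" by blast
  qed
qed simp

lemma one_in_zero_one_vectors: "1 \<in> zero_one_vectors"
  by (auto simp: zero_one_vectors_def vec_eq_iff)

lemma finite_rayleigh_quotients:
  fixes A :: "complex ^ 'n ^ 'm"
  shows "finite {cmod (scalar_product \<xi> (A *v \<eta>)) / (norm \<xi> * norm \<eta>) | \<xi> \<eta>.
            \<xi> \<in> zero_one_vectors \<and> \<eta> \<in> zero_one_vectors}"
  by (rule finite_image_set2) (simp_all add: finite_zero_one_vectors)

end

theory Submission 
  imports Defs "HOL-Real_Asymp.Real_Asymp"
begin

text \<open>
  Write a nonnegative vector in binary, \<open>x = (\<Sum>k. 2 ^ k *s \<xi> k)\<close> with 0/1 vectors \<open>\<xi> k\<close>;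
  then \<open>(\<Sum>k. (2 ^ k * norm (\<xi> k))\<^sup>2) \<le> (norm x)\<^sup>2\<close>. In the double sum for the bilinear form at
  \<open>x, y\<close> the terms whose levels differ much are controlled by the row and column norms and decay
  geometrically, so together they contribute at most an eighth of the operator norm. The remaining
  band has about \<open>2 * log 2 (height A)\<close> diagonals, each contributing at most
  \<open>rayleigh_norm A * norm x * norm y\<close>. Splitting a complex vector into four nonnegative parts costs a
  factor 4, and half of the operator norm is then absorbed on the left.
\<close>

section \<open>Sums over dyadic levels and the band estimate\<close>

lemma sum_power2_upto_le:
  fixes z :: real
  shows "(\<Sum>l | l < M \<and> real l \<le> z. 2 ^ l) \<le> 2 * 2 powr z"
\<comment> \<open>For negative \<open>z\<close> the index set is empty, whereas
  \<open>nat \<lfloor>z\<rfloor>\<close> would be 0 and exceed \<open>z\<close>.\<close>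
proof (cases "z < 0")
  case True
  then have empty: "{l. l < M \<and> real l \<le> z} = {}" by (auto simp: not_le intro: less_le_trans)
  show ?thesis unfolding empty by simp
next
  case False
  define n where "n = nat \<lfloor>z\<rfloor>"
  have n: "real n \<le> z" "real l \<le> z \<Longrightarrow> l < Suc n" for l
    using False by (auto simp: n_def le_nat_iff le_floor_iff less_Suc_eq_le)
  have "(\<Sum>l | l < M \<and> real l \<le> z. 2 ^ l) \<le> (\<Sum>l<Suc n. 2 ^ l :: real)"
    by (rule sum_mono2) (use n in auto)
  also have "\<dots> \<le> 2 * 2 ^ n"
    by (simp add: sum_gp_strict)
  also have "\<dots> = 2 * 2 powr n" by (simp add: powr_realpow)
  also have "\<dots> \<le> 2 * 2 powr z" using n by simp
  finally show ?thesis .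
qed

lemma card_nats_in_interval_le:
  fixes a b :: real
  shows "real (card {l::nat. l < M \<and> a < real l \<and> real l < b}) \<le> max 0 (b - a + 1)"
proof -
  let ?S = "{l::nat. l < M \<and> a < real l \<and> real l < b}"
  have "card ?S = card (int ` ?S)" by (simp add: card_image)
  also have "\<dots> \<le> card {\<lfloor>a\<rfloor> <..< \<lceil>b\<rceil>}"
  proof (rule card_mono)
    show "int ` ?S \<subseteq> {\<lfloor>a\<rfloor> <..< \<lceil>b\<rceil>}" by (auto simp: floor_less_iff less_ceiling_iff)
  qed simp
  also have "\<dots> = nat (\<lceil>b\<rceil> - \<lfloor>a\<rfloor> - 1)" by simp
  finally have "real (card ?S) \<le> real (nat (\<lceil>b\<rceil> - \<lfloor>a\<rfloor> - 1))" by simp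
  also have "\<dots> = max 0 (of_int (\<lceil>b\<rceil> - \<lfloor>a\<rfloor> - 1))" by (simp add: max_def)
  \<comment> \<open>Since \<open>\<lceil>b\<rceil> < b + 1\<close> and
    \<open>a - 1 < \<lfloor>a\<rfloor>\<close>, rounding the two ends costs less than 2.\<close>
  also have "\<dots> \<le> max 0 (b - a + 1)" by linarith
  finally show ?thesis .
qed

text \<open>A Schur test on the band \<open>- u < l - k < v\<close>, where the bound with
  \<open>p\<close> is used; on either side of it the bound with \<open>R\<close> or \<open>C\<close>
  sums as a geometric series. The cut-offs are real, so they can later be chosen without rounding,
  and \<open>max 0\<close> covers an empty band.\<close>

lemma band_sum_le:
  fixes X Y :: "nat \<Rightarrow> real" and T :: "nat \<Rightarrow> nat \<Rightarrow> real"
  assumes X: "\<And>k. X k \<ge> 0" and Y: "\<And>k. Y k \<ge> 0" and "p \<ge> 0" "R \<ge> 0" "C \<ge> 0" "a > 0" "b > 0"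
    and Tp: "\<And>k l. T k l \<le> p * (X k * Y l)"
    and TR: "\<And>k l. T k l \<le> R * 2 ^ l / 2 ^ k * (X k)\<^sup>2"
    and TC: "\<And>k l. T k l \<le> C * 2 ^ k / 2 ^ l * (Y l)\<^sup>2"
    and SX: "(\<Sum>k<M. (X k)\<^sup>2) \<le> a\<^sup>2" and SY: "(\<Sum>k<M. (Y k)\<^sup>2) \<le> b\<^sup>2"
  shows "(\<Sum>k<M. \<Sum>l<M. T k l) \<le> p * max 0 (u + v + 1) * (a * b)
           + 2 * R * 2 powr (- u) * a\<^sup>2 + 2 * C * 2 powr (- v) * b\<^sup>2"
proof -
  define W where "W = max 0 (u + v + 1)"
  define mid where "mid k l \<longleftrightarrow> real k - u < real l \<and> real l < real k + v" for k l
  define f1 where "f1 k l = (if mid k l then p * (X k * Y l) else 0)" for k l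
  define f2 where "f2 k l = (if real l \<le> real k - u then R * 2 ^ l / 2 ^ k * (X k)\<^sup>2 else 0)" for k l
  define f3 where "f3 k l = (if real k \<le> real l - v then C * 2 ^ k / 2 ^ l * (Y l)\<^sup>2 else 0)" for k l
  have pos: "f1 k l \<ge> 0" "f2 k l \<ge> 0" "f3 k l \<ge> 0" for k l
    using assms(1-5) by (auto simp: f1_def f2_def f3_def)
  \<comment> \<open>The two tail regions may overlap when \<open>u + v\<close> is not positive; it
    is enough that the three regions cover all pairs, since the majorants are nonnegative.\<close>
  have T: "T k l \<le> f1 k l + f2 k l + f3 k l" for k l
  proof -
    consider "mid k l" | "real l \<le> real k - u" | "real k \<le> real l - v"
      unfolding mid_def by linarith
    then show ?thesis
    proof cases
      case 1
      then have "T k l \<le> f1 k l" using Tp by (simp add: f1_def)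
      with pos[of k l] show ?thesis by linarith
    next
      case 2
      then have "T k l \<le> f2 k l" using TR by (simp add: f2_def)
      with pos[of k l] show ?thesis by linarith
    next
      case 3
      then have "T k l \<le> f3 k l" using TC by (simp add: f3_def)
      with pos[of k l] show ?thesis by linarith
    qed
  qed
  \<comment> \<open>Stated for fresh \<open>R\<close>, \<open>u\<close>, \<open>a\<close>,
    \<open>X\<close> so that it serves both tails, the second one after swapping the sums. The sum
    over \<open>l\<close> is at most twice \<open>2 powr (real k - u)\<close>, and the division by
    \<open>2 ^ k\<close> removes the dependence on \<open>k\<close>.\<close>
  have tail: "(\<Sum>k<M. \<Sum>l<M. if real l \<le> real k - u then R * 2 ^ l / 2 ^ k * (X k)\<^sup>2 else 0)
      \<le> 2 * R * 2 powr (- u) * a\<^sup>2"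
    if "R \<ge> 0" and SX: "(\<Sum>k<M. (X k)\<^sup>2) \<le> a\<^sup>2" for R u a and X :: "nat \<Rightarrow> real"
  proof -
    have "(\<Sum>l<M. if real l \<le> real k - u then R * 2 ^ l / 2 ^ k * (X k)\<^sup>2 else 0)
        \<le> 2 * R * 2 powr (- u) * (X k)\<^sup>2" for k
    proof -
      have "(\<Sum>l<M. if real l \<le> real k - u then R * 2 ^ l / 2 ^ k * (X k)\<^sup>2 else 0)
          = (\<Sum>l | l < M \<and> real l \<le> real k - u. R * 2 ^ l / 2 ^ k * (X k)\<^sup>2)"
        by (rule sum.mono_neutral_cong_right) auto
      also have "\<dots> = R / 2 ^ k * (X k)\<^sup>2 * (\<Sum>l | l < M \<and> real l \<le> real k - u. 2 ^ l)"
        by (simp add: sum_distrib_left mult_ac)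
      also have "\<dots> \<le> R / 2 ^ k * (X k)\<^sup>2 * (2 * 2 powr (real k - u))"
        using that by (intro mult_left_mono sum_power2_upto_le) auto
      also have "\<dots> = 2 * R * 2 powr (- u) * (X k)\<^sup>2"
        by (simp add: powr_diff powr_minus powr_realpow field_simps)
      finally show ?thesis .
    qed
    then have "(\<Sum>k<M. \<Sum>l<M. if real l \<le> real k - u then R * 2 ^ l / 2 ^ k * (X k)\<^sup>2 else 0)
        \<le> (\<Sum>k<M. 2 * R * 2 powr (- u) * (X k)\<^sup>2)" by (intro sum_mono)
    also have "\<dots> = 2 * R * 2 powr (- u) * (\<Sum>k<M. (X k)\<^sup>2)" by (simp add: sum_distrib_left)
    also have "\<dots> \<le> 2 * R * 2 powr (- u) * a\<^sup>2"
      using that by (intro mult_left_mono) auto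
    finally show ?thesis .
  qed
  have F2: "(\<Sum>k<M. \<Sum>l<M. f2 k l) \<le> 2 * R * 2 powr (- u) * a\<^sup>2"
    unfolding f2_def by (rule tail) (use assms in auto)
  have F3: "(\<Sum>k<M. \<Sum>l<M. f3 k l) \<le> 2 * C * 2 powr (- v) * b\<^sup>2"
    unfolding f3_def by (subst sum.swap, rule tail) (use assms in auto)
  have rows: "(\<Sum>k<M. \<Sum>l<M. if mid k l then (X k)\<^sup>2 else 0) \<le> W * a\<^sup>2"
  proof -
    have "(\<Sum>l<M. if mid k l then (X k)\<^sup>2 else 0) \<le> W * (X k)\<^sup>2" for k
    proof -
      have "(\<Sum>l<M. if mid k l then (X k)\<^sup>2 else 0) = (\<Sum>l | l < M \<and> mid k l. (X k)\<^sup>2)"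
        by (rule sum.mono_neutral_cong_right) auto
      also have "\<dots> = real (card {l. l < M \<and> real k - u < real l \<and> real l < real k + v}) * (X k)\<^sup>2"
        by (simp add: mid_def)
      also have "\<dots> \<le> W * (X k)\<^sup>2"
        using card_nats_in_interval_le[of M "real k - u" "real k + v"]
        by (intro mult_right_mono) (auto simp: W_def algebra_simps)
      finally show ?thesis .
    qed
    then have "(\<Sum>k<M. \<Sum>l<M. if mid k l then (X k)\<^sup>2 else 0) \<le> (\<Sum>k<M. W * (X k)\<^sup>2)"
      by (intro sum_mono)
    also have "\<dots> = W * (\<Sum>k<M. (X k)\<^sup>2)" by (simp add: sum_distrib_left)
    also have "\<dots> \<le> W * a\<^sup>2" using SX by (intro mult_left_mono) (auto simp: W_def)
    finally show ?thesis .
  qed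
  have cols: "(\<Sum>k<M. \<Sum>l<M. if mid k l then (Y l)\<^sup>2 else 0) \<le> W * b\<^sup>2"
  proof -
    have "(\<Sum>k<M. if mid k l then (Y l)\<^sup>2 else 0) \<le> W * (Y l)\<^sup>2" for l
    proof -
      have "(\<Sum>k<M. if mid k l then (Y l)\<^sup>2 else 0) = (\<Sum>k | k < M \<and> mid k l. (Y l)\<^sup>2)"
        by (rule sum.mono_neutral_cong_right) auto
      \<comment> \<open>Seen from a column, the band is an interval of the same length
        \<open>u + v\<close>, so rows and columns share the count \<open>W\<close>.\<close>
      also have "{k. k < M \<and> mid k l} = {k. k < M \<and> real l - v < real k \<and> real k < real l + u}"
        by (auto simp: mid_def)
      also have "(\<Sum>k\<in>\<dots>. (Y l)\<^sup>2) = real (card \<dots>) * (Y l)\<^sup>2" by simp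
      also have "\<dots> \<le> W * (Y l)\<^sup>2"
        using card_nats_in_interval_le[of M "real l - v" "real l + u"]
        by (intro mult_right_mono) (auto simp: W_def algebra_simps)
      finally show ?thesis .
    qed
    then have "(\<Sum>l<M. \<Sum>k<M. if mid k l then (Y l)\<^sup>2 else 0) \<le> (\<Sum>l<M. W * (Y l)\<^sup>2)"
      by (intro sum_mono)
    also have "\<dots> = W * (\<Sum>k<M. (Y k)\<^sup>2)" by (simp add: sum_distrib_left)
    also have "\<dots> \<le> W * b\<^sup>2" using SY by (intro mult_left_mono) (auto simp: W_def)
    finally show ?thesis by (subst sum.swap)
  qed
  \<comment> \<open>The weights balance the two halves: once summed,
    \<open>b / a * a\<^sup>2\<close> and \<open>a / b * b\<^sup>2\<close> both equal
    \<open>a * b\<close>.\<close>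
  have amgm: "X k * Y l \<le> (b / a * (X k)\<^sup>2 + a / b * (Y l)\<^sup>2) / 2" for k l
  proof -
    have "0 \<le> (b * X k - a * Y l)\<^sup>2 / (2 * a * b)" using assms by simp
    also have "\<dots> = (b / a * (X k)\<^sup>2 + a / b * (Y l)\<^sup>2) / 2 - X k * Y l"
      using assms by (simp add: field_simps power2_eq_square)
    finally show ?thesis by simp
  qed
  have "(\<Sum>k<M. \<Sum>l<M. f1 k l) \<le> (\<Sum>k<M. \<Sum>l<M. p / 2 * (b / a * (if mid k l then (X k)\<^sup>2 else 0)
      + a / b * (if mid k l then (Y l)\<^sup>2 else 0)))"
    using mult_left_mono[OF amgm \<open>p \<ge> 0\<close>] by (intro sum_mono) (auto simp: f1_def)
  also have "\<dots> = p / 2 * (b / a * (\<Sum>k<M. \<Sum>l<M. if mid k l then (X k)\<^sup>2 else 0)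
      + a / b * (\<Sum>k<M. \<Sum>l<M. if mid k l then (Y l)\<^sup>2 else 0))"
    by (simp only: sum_distrib_left sum.distrib[symmetric])
  also have "\<dots> \<le> p / 2 * (b / a * (W * a\<^sup>2) + a / b * (W * b\<^sup>2))"
    using assms by (intro mult_left_mono add_mono rows cols) auto
  also have "\<dots> = p * W * (a * b)"
    using assms by (simp add: field_simps power2_eq_square)
  finally have F1: "(\<Sum>k<M. \<Sum>l<M. f1 k l) \<le> p * W * (a * b)" .
  have "(\<Sum>k<M. \<Sum>l<M. T k l) \<le> (\<Sum>k<M. \<Sum>l<M. f1 k l + f2 k l + f3 k l)"
    by (intro sum_mono T)
  also have "\<dots> = (\<Sum>k<M. \<Sum>l<M. f1 k l) + (\<Sum>k<M. \<Sum>l<M. f2 k l) + (\<Sum>k<M. \<Sum>l<M. f3 k l)"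
    by (simp add: sum.distrib)
  finally show ?thesis using F1 F2 F3 unfolding W_def by linarith
qed

section \<open>The bilinear form and the operator norm\<close>

lemma L2_norm_squared_vec:
  fixes u :: "'a::real_normed_vector ^ 'n"
  shows "(norm u)\<^sup>2 = (\<Sum>i\<in>UNIV. (norm (u $ i))\<^sup>2)"
  by (simp add: norm_vec_def L2_set_def sum_nonneg)

definition bform :: "complex ^ 'n ^ 'm \<Rightarrow> complex ^ 'm \<Rightarrow> complex ^ 'n \<Rightarrow> complex" where
  "bform A u v = scalar_product u (A *v v)"

lemma bform_eq_sum: "bform A u v = (\<Sum>i\<in>UNIV. \<Sum>j\<in>UNIV. u $ i * A $ i $ j * v $ j)"
  by (simp add: bform_def scalar_product_def matrix_vector_mult_def sum_distrib_left mult.assoc)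

lemma bform_scale: "bform A (c *s u) (d *s v) = c * d * bform A u v"
  by (simp add: bform_eq_sum sum_distrib_left mult_ac)

lemma bform_sum: "bform A (\<Sum>k\<in>K. f k) (\<Sum>l\<in>L. g l) = (\<Sum>k\<in>K. \<Sum>l\<in>L. bform A (f k) (g l))"
proof -
  have left: "bform A (\<Sum>k\<in>K. f k) v = (\<Sum>k\<in>K. bform A (f k) v)" for v
    unfolding bform_eq_sum sum_component sum_distrib_right
    by (subst sum.swap[of _ _ K], rule sum.cong[OF refl], subst sum.swap[of _ _ K]) simp
  have right: "bform A u (\<Sum>l\<in>L. g l) = (\<Sum>l\<in>L. bform A u (g l))" for u
    unfolding bform_eq_sum sum_component sum_distrib_left
    by (subst sum.swap[of _ _ L], rule sum.cong[OF refl], subst sum.swap[of _ _ L]) simp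
  have "bform A (\<Sum>k\<in>K. f k) (\<Sum>l\<in>L. g l) = (\<Sum>k\<in>K. bform A (f k) (\<Sum>l\<in>L. g l))"
    by (rule left)
  also have "\<dots> = (\<Sum>k\<in>K. \<Sum>l\<in>L. bform A (f k) (g l))"
    by (rule sum.cong[OF refl right])
  finally show ?thesis .
qed

lemma bform_zero [simp]: "bform A 0 v = 0" "bform A u 0 = 0"
  by (simp_all add: bform_eq_sum)

lemma tendsto_bform:
  assumes "(f \<longlongrightarrow> u) F" "(g \<longlongrightarrow> v) F"
  shows "((\<lambda>t. bform A (f t) (g t)) \<longlongrightarrow> bform A u v) F"
  unfolding bform_eq_sum using assms by (intro tendsto_intros)

lemma bounded_linear_matrix_vector_mult:
  fixes A :: "complex ^ 'n ^ 'm"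
  shows "bounded_linear ((*v) A)"
  by (intro linear_conv_bounded_linear[THEN iffD1] linearI)
    (simp_all add: vec_eq_iff matrix_vector_mult_def scaleR_sum_right distrib_left sum.distrib)

lemma cmod_scalar_product_le: "cmod (scalar_product u v) \<le> norm u * norm v"
proof -
  have "cmod (scalar_product u v) \<le> (\<Sum>i\<in>UNIV. \<bar>cmod (u $ i)\<bar> * \<bar>cmod (v $ i)\<bar>)"
    unfolding scalar_product_def by (rule sum_norm_le) (simp add: norm_mult)
  also have "\<dots> \<le> norm u * norm v"
    unfolding norm_vec_def by (rule L2_set_mult_ineq)
  finally show ?thesis .
qed

lemma op_norm_nonneg: "op_norm A \<ge> 0"
  unfolding op_norm_def by (intro onorm_pos_le bounded_linear_matrix_vector_mult)

lemma op_norm_pos: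
  assumes "A \<noteq> 0"
  shows "op_norm A > 0"
proof -
  have "\<exists>x. A *v x \<noteq> 0"
    using assms matrix_eq[of A 0] by (auto simp: matrix_vector_mult_0)
  then show ?thesis
    unfolding op_norm_def by (simp add: onorm_pos_lt[OF bounded_linear_matrix_vector_mult])
qed

lemma cmod_bform_le_op_norm: "cmod (bform A u v) \<le> op_norm A * norm u * norm v"
proof -
  have "cmod (bform A u v) \<le> norm u * norm (A *v v)"
    unfolding bform_def by (rule cmod_scalar_product_le)
  also have "\<dots> \<le> norm u * (op_norm A * norm v)"
    unfolding op_norm_def
    by (intro mult_left_mono onorm bounded_linear_matrix_vector_mult) simp
  finally show ?thesis by (simp add: mult_ac)
qed

text \<open>Taking for \<open>u\<close> the conjugate of \<open>A *v v\<close> turns the bilinear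
  form into the squared norm of \<open>A *v v\<close>, and one factor of that norm cancels.\<close>

lemma op_norm_le:
  fixes A :: "complex ^ 'n ^ 'm"
  assumes bound: "\<And>u v. cmod (bform A u v) \<le> K * norm u * norm v"
  shows "op_norm A \<le> K"
  unfolding op_norm_def
proof (rule onorm_le)
  fix v
  define u :: "complex ^ 'm" where "u = (\<chi> i. cnj ((A *v v) $ i))"
  have nu: "norm u = norm (A *v v)" by (simp add: u_def norm_vec_def)
  have "bform A u v = of_real ((norm (A *v v))\<^sup>2)"
    unfolding bform_def scalar_product_def L2_norm_squared_vec
    by (simp only: u_def vec_lambda_beta of_real_sum complex_norm_square mult.commute)
  then have "norm (A *v v) * norm (A *v v) \<le> norm (A *v v) * (K * norm v)"
    using bound[of u v] by (simp add: nu power2_eq_square mult_ac norm_mult)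
  \<comment> \<open>The sign of \<open>K\<close> is not assumed but follows from the bound at the
    all-ones vector; the case \<open>A *v v = 0\<close> relies on it.\<close>
  moreover have "0 \<le> K * norm v"
  proof -
    define c where "c = norm (1 :: complex ^ 'm)"
    have "0 \<le> K * c * norm v"
      unfolding c_def using bound[of 1 v] norm_ge_zero order_trans by blast
    moreover have "c > 0" by (simp add: c_def vec_eq_iff)
    ultimately show ?thesis by (auto simp: zero_le_mult_iff)
  qed
  ultimately show "norm (A *v v) \<le> K * norm v"
    by (cases "norm (A *v v) = 0") (auto simp: mult_le_cancel_left)
qed

section \<open>Three bounds for the form at 0/1 vectors\<close>

lemma cmod_bform_le_rayleigh_norm:
  assumes "\<And>i. \<xi> $ i \<in> {0, 1}" "\<And>j. \<eta> $ j \<in> {0, 1}"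
  shows "cmod (bform A \<xi> \<eta>) \<le> rayleigh_norm A * (norm \<xi> * norm \<eta>)"
proof (cases "\<xi> = 0 \<or> \<eta> = 0")
  case False
  then have "\<xi> \<in> zero_one_vectors" "\<eta> \<in> zero_one_vectors"
    using assms by (auto simp: zero_one_vectors_def)
  then have "cmod (bform A \<xi> \<eta>) / (norm \<xi> * norm \<eta>) \<le> rayleigh_norm A"
    unfolding rayleigh_norm_def bform_def by (intro Max_ge finite_rayleigh_quotients) auto
  with False show ?thesis by (simp add: divide_le_eq)
qed auto

lemma rayleigh_norm_attained:
  fixes A :: "complex ^ 'n ^ 'm"
  obtains \<xi> \<eta> where "\<xi> \<in> zero_one_vectors" "\<eta> \<in> zero_one_vectors"
    "rayleigh_norm A = cmod (bform A \<xi> \<eta>) / (norm \<xi> * norm \<eta>)"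
proof -
  have "rayleigh_norm A \<in> {cmod (scalar_product \<xi> (A *v \<eta>)) / (norm \<xi> * norm \<eta>) | \<xi> \<eta>.
            \<xi> \<in> zero_one_vectors \<and> \<eta> \<in> zero_one_vectors}"
    unfolding rayleigh_norm_def
  proof (rule Max_in[OF finite_rayleigh_quotients])
    show "{cmod (scalar_product \<xi> (A *v \<eta>)) / (norm \<xi> * norm \<eta>) | \<xi> \<eta>.
            \<xi> \<in> zero_one_vectors \<and> \<eta> \<in> zero_one_vectors} \<noteq> {}"
      using one_in_zero_one_vectors[where ?'a = 'm] one_in_zero_one_vectors[where ?'a = 'n]
      by auto
  qed
  then show ?thesis using that unfolding bform_def by blast
qed

lemma rayleigh_norm_nonneg: "rayleigh_norm A \<ge> 0"
  by (rule rayleigh_norm_attained[of A]) simp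

lemma rayleigh_norm_le_op_norm: "rayleigh_norm A \<le> op_norm A"
proof (rule rayleigh_norm_attained[of A])
  fix \<xi> \<eta> assume "\<xi> \<in> zero_one_vectors" "\<eta> \<in> zero_one_vectors"
    and "rayleigh_norm A = cmod (bform A \<xi> \<eta>) / (norm \<xi> * norm \<eta>)"
  then show ?thesis
    using cmod_bform_le_op_norm[of A \<xi> \<eta>]
    by (simp add: zero_one_vectors_def divide_le_eq mult.assoc)
qed

lemma row_sum_le: "(\<Sum>j\<in>UNIV. cmod (A $ i $ j)) \<le> row_norm A"
  unfolding row_norm_def by (rule Max_ge) auto

lemma col_sum_le: "(\<Sum>i\<in>UNIV. cmod (A $ i $ j)) \<le> col_norm A"
  unfolding col_norm_def by (rule Max_ge) auto

lemma
  assumes "A \<noteq> 0"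
  shows row_norm_pos: "row_norm A > 0" and col_norm_pos: "col_norm A > 0"
proof -
  obtain i j where "A $ i $ j \<noteq> 0" using assms by (auto simp: vec_eq_iff)
  then have "0 < cmod (A $ i $ j)" by simp
  also have "cmod (A $ i $ j) \<le> (\<Sum>j\<in>UNIV. cmod (A $ i $ j))" by (rule member_le_sum) auto
  also note row_sum_le
  finally show "row_norm A > 0" .
  have "0 < cmod (A $ i $ j)" using \<open>A $ i $ j \<noteq> 0\<close> by simp
  also have "cmod (A $ i $ j) \<le> (\<Sum>i\<in>UNIV. cmod (A $ i $ j))" by (rule member_le_sum) auto
  also note col_sum_le
  finally show "col_norm A > 0" .
qed

lemma cmod_bform_le_sums:
  "cmod (bform A u v) \<le> (\<Sum>i\<in>UNIV. \<Sum>j\<in>UNIV. cmod (u $ i) * cmod (A $ i $ j) * cmod (v $ j))"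
  unfolding bform_eq_sum by (intro sum_norm_le) (simp add: norm_mult)

text \<open>Entries of \<open>\<eta>\<close> have modulus at most 1, so each row selected by
  \<open>\<xi>\<close> contributes at most its absolute row sum. The number of selected rows is the
  squared norm of \<open>\<xi>\<close>, since 0 and 1 equal their squares.\<close>

lemma cmod_bform_le_row_norm:
  assumes \<xi>: "\<And>i. \<xi> $ i \<in> {0, 1}" and \<eta>: "\<And>j. \<eta> $ j \<in> {0, 1}"
  shows "cmod (bform A \<xi> \<eta>) \<le> row_norm A * (norm \<xi>)\<^sup>2"
proof -
  note cmod_bform_le_sums[of A \<xi> \<eta>]
  also have "(\<Sum>i\<in>UNIV. \<Sum>j\<in>UNIV. cmod (\<xi> $ i) * cmod (A $ i $ j) * cmod (\<eta> $ j))
      \<le> (\<Sum>i\<in>UNIV. cmod (\<xi> $ i) * (\<Sum>j\<in>UNIV. cmod (A $ i $ j)))"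
    unfolding sum_distrib_left
  proof (intro sum_mono)
    fix i j
    show "cmod (\<xi> $ i) * cmod (A $ i $ j) * cmod (\<eta> $ j) \<le> cmod (\<xi> $ i) * cmod (A $ i $ j)"
      using \<eta>[of j] by auto
  qed
  also have "\<dots> \<le> (\<Sum>i\<in>UNIV. (cmod (\<xi> $ i))\<^sup>2 * row_norm A)"
  proof (rule sum_mono)
    fix i
    show "cmod (\<xi> $ i) * (\<Sum>j\<in>UNIV. cmod (A $ i $ j)) \<le> (cmod (\<xi> $ i))\<^sup>2 * row_norm A"
      using \<xi>[of i] row_sum_le[of A i] by auto
  qed
  also have "\<dots> = row_norm A * (norm \<xi>)\<^sup>2"
    by (simp add: L2_norm_squared_vec sum_distrib_left mult.commute)
  finally show ?thesis .
qed

lemma bform_transpose: "bform (transpose A) v u = bform A u v"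
  unfolding bform_eq_sum by (subst sum.swap) (simp add: transpose_def mult_ac)

lemma row_norm_transpose: "row_norm (transpose A) = col_norm A"
  by (simp add: row_norm_def col_norm_def transpose_def)

lemma cmod_bform_le_col_norm:
  assumes "\<And>i. \<xi> $ i \<in> {0, 1}" and "\<And>j. \<eta> $ j \<in> {0, 1}"
  shows "cmod (bform A \<xi> \<eta>) \<le> col_norm A * (norm \<eta>)\<^sup>2"
  using cmod_bform_le_row_norm[of \<eta> \<xi> "transpose A"] assms
  by (simp add: bform_transpose row_norm_transpose)

section \<open>Binary expansion of vectors of natural numbers\<close>

abbreviation nat_vec :: "('n \<Rightarrow> nat) \<Rightarrow> complex ^ 'n" where
  "nat_vec x \<equiv> \<chi> i. of_nat (x i)"

abbreviation real_vec :: "('n \<Rightarrow> real) \<Rightarrow> complex ^ 'n" where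
  "real_vec x \<equiv> \<chi> i. of_real (x i)"

definition digit_vec :: "nat \<Rightarrow> ('n \<Rightarrow> nat) \<Rightarrow> complex ^ 'n" where
  "digit_vec k x = (\<chi> i. of_bool (bit (x i) k))"

lemma digit_vec_zero_one: "digit_vec k x $ i \<in> {0, 1}"
  by (simp add: digit_vec_def)

lemma binary_expansion:
  fixes n :: nat
  assumes "n < 2 ^ M"
  shows "n = (\<Sum>k<M. 2 ^ k * of_bool (bit n k))"
proof -
  have "n = take_bit M n" using assms by (simp add: take_bit_nat_eq_self)
  then show ?thesis
    by (simp add: take_bit_sum push_bit_eq_mult atLeast0LessThan mult.commute)
qed

lemma vec_eq_sum_digit_vec:
  assumes "\<And>i. x i < 2 ^ M"
  shows "nat_vec x = (\<Sum>k<M. 2 ^ k *s digit_vec k x)"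
  unfolding vec_eq_iff
proof
  fix i
  have "(of_nat (x i) :: complex) = of_nat (\<Sum>k<M. 2 ^ k * of_bool (bit (x i) k))"
    using binary_expansion[OF assms[of i]] by simp
  then show "nat_vec x $ i = (\<Sum>k<M. 2 ^ k *s digit_vec k x) $ i"
    by (simp add: digit_vec_def sum_component)
qed

text \<open>The cross terms in the square of a binary expansion are nonnegative.\<close>

lemma sum_norm_digit_vec_le:
  fixes x :: "'n::finite \<Rightarrow> nat"
  assumes "\<And>i. x i < 2 ^ M"
  shows "(\<Sum>k<M. (2 ^ k * norm (digit_vec k x))\<^sup>2) \<le> (norm (nat_vec x))\<^sup>2"
proof -
  have "cmod (of_bool P) = of_bool P" for P by (cases P) auto
  then have "(\<Sum>k<M. (2 ^ k * norm (digit_vec k x))\<^sup>2)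
      = (\<Sum>i\<in>UNIV. \<Sum>k<M. (2 ^ k * of_bool (bit (x i) k))\<^sup>2)"
    by (subst sum.swap) (simp add: power_mult_distrib L2_norm_squared_vec digit_vec_def sum_distrib_left)
  also have "\<dots> \<le> (\<Sum>i\<in>UNIV. (real (x i))\<^sup>2)"
  proof (rule sum_mono)
    fix i
    define f where "f k = (2 ^ k * of_bool (bit (x i) k) :: real)" for k
    have "L2_set f {..<M} \<le> (\<Sum>k<M. f k)" by (rule L2_set_le_sum) (simp add: f_def)
    also have "\<dots> = real (\<Sum>k<M. 2 ^ k * of_bool (bit (x i) k))" by (simp add: f_def)
    also have "\<dots> = real (x i)" using binary_expansion[OF assms[of i]] by simp
    finally have "(L2_set f {..<M})\<^sup>2 \<le> (real (x i))\<^sup>2" by (intro power_mono L2_set_nonneg)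
    then show "(\<Sum>k<M. (2 ^ k * of_bool (bit (x i) k))\<^sup>2) \<le> (real (x i))\<^sup>2"
      by (simp add: L2_set_def sum_nonneg f_def)
  qed
  also have "\<dots> = (norm (nat_vec x))\<^sup>2"
    by (simp add: L2_norm_squared_vec)
  finally show ?thesis .
qed

section \<open>The estimate at vectors of natural numbers\<close>

lemma cmod_bform_nat_le:
  fixes A :: "complex ^ 'n ^ 'm" and x :: "'m \<Rightarrow> nat" and y :: "'n \<Rightarrow> nat"
  assumes "A \<noteq> 0"
  defines "N \<equiv> op_norm A"
  defines "X \<equiv> nat_vec x" and "Y \<equiv> nat_vec y"
  shows "cmod (bform A X Y)
    \<le> (rayleigh_norm A * max 0 (11 + 2 * log 2 (height A)) + N / 8) * (norm X * norm Y)"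
\<comment> \<open>The cut-offs below divide by both norms; at a zero vector both sides
  vanish.\<close>
proof (cases "X = 0 \<or> Y = 0")
  case False
  then have pos: "norm X > 0" "norm Y > 0" "N > 0" "row_norm A > 0" "col_norm A > 0"
    using assms by (auto simp: op_norm_pos row_norm_pos col_norm_pos)
  define R C where "R = row_norm A" and "C = col_norm A"
  \<comment> \<open>These cut-offs make each of the two tails at most \<open>N / 16 * norm X * norm Y\<close>.\<close>
  define u where "u = log 2 (32 * R * norm X / (N * norm Y))"
  define v where "v = log 2 (32 * C * norm Y / (N * norm X))"
  have RC: "R > 0" "C > 0" using pos by (auto simp: R_def C_def)
  have powr: "2 powr (- u) = N * norm Y / (32 * R * norm X)" "2 powr (- v) = N * norm X / (32 * C * norm Y)"
    using pos RC by (simp_all add: u_def v_def powr_minus)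
  have h: "(height A)\<^sup>2 = R * C / N\<^sup>2" "height A > 0"
    using pos RC by (auto simp: height_def R_def C_def N_def power_divide mult.commute)
  \<comment> \<open>The norms of \<open>X\<close> and \<open>Y\<close> cancel in the sum, so the
    width of the band depends on the height alone; 1024 is the square of the 32 in the
    cut-offs.\<close>
  have "u + v = log 2 (1024 * (R * C / N\<^sup>2))"
    unfolding u_def v_def using pos RC
    by (subst log_mult_pos[symmetric]) (auto simp: field_simps power2_eq_square)
  also have "\<dots> = log 2 (2 ^ 10) + log 2 ((height A)\<^sup>2)"
    unfolding h(1)[symmetric] using h(2) by (subst log_mult_pos) auto
  also have "\<dots> = 10 + 2 * log 2 (height A)"
    using h(2) by (simp only: log_nat_power) simp
  finally have uv: "u + v + 1 = 11 + 2 * log 2 (height A)" by simp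
  \<comment> \<open>Any common bound on the entries serves as the number of digits, because
    \<open>n < 2 ^ n\<close>.\<close>
  define M where "M = (\<Sum>i\<in>UNIV. x i) + (\<Sum>j\<in>UNIV. y j)"
  have "x i \<le> M" "y j \<le> M" for i j
    using member_le_sum[of i UNIV x] member_le_sum[of j UNIV y] by (auto simp: M_def)
  then have M: "x i < 2 ^ M" "y j < 2 ^ M" for i j
    by (meson le_less_trans less_exp)+
  define \<xi> \<eta> where "\<xi> = (\<lambda>k. digit_vec k x)" and "\<eta> = (\<lambda>k. digit_vec k y)"
  have "bform A X Y = (\<Sum>k<M. \<Sum>l<M. 2 ^ k * 2 ^ l * bform A (\<xi> k) (\<eta> l))"
    unfolding X_def Y_def \<xi>_def \<eta>_def vec_eq_sum_digit_vec[of x, OF M(1)] vec_eq_sum_digit_vec[of y, OF M(2)]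
    by (simp only: bform_sum bform_scale)
  also have "cmod \<dots> \<le> (\<Sum>k<M. \<Sum>l<M. 2 ^ k * 2 ^ l * cmod (bform A (\<xi> k) (\<eta> l)))"
    by (intro sum_norm_le) (simp add: norm_mult norm_power)
  also have "\<dots> \<le> rayleigh_norm A * max 0 (u + v + 1) * (norm X * norm Y)
           + 2 * R * 2 powr (- u) * (norm X)\<^sup>2 + 2 * C * 2 powr (- v) * (norm Y)\<^sup>2"
  \<comment> \<open>With the levels built into the sequences, the row bound
    \<open>R * (norm (\<xi> k))\<^sup>2\<close> times \<open>2 ^ k * 2 ^ l\<close> becomes
    \<open>R * 2 ^ l / 2 ^ k\<close> times a squared term; the column bound is symmetric.\<close>
  proof (rule band_sum_le[where X = "\<lambda>k. 2 ^ k * norm (\<xi> k)" and Y = "\<lambda>k. 2 ^ k * norm (\<eta> k)"])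
    fix k l
    note zero_one = digit_vec_zero_one[of k x, folded \<xi>_def] digit_vec_zero_one[of l y, folded \<eta>_def]
    show "2 ^ k * 2 ^ l * cmod (bform A (\<xi> k) (\<eta> l))
        \<le> rayleigh_norm A * (2 ^ k * norm (\<xi> k) * (2 ^ l * norm (\<eta> l)))"
      using cmod_bform_le_rayleigh_norm[of "\<xi> k" "\<eta> l" A] zero_one by (simp add: \<xi>_def \<eta>_def mult_ac)
    show "2 ^ k * 2 ^ l * cmod (bform A (\<xi> k) (\<eta> l)) \<le> R * 2 ^ l / 2 ^ k * (2 ^ k * norm (\<xi> k))\<^sup>2"
      using cmod_bform_le_row_norm[of "\<xi> k" "\<eta> l" A] zero_one
      by (simp add: \<xi>_def \<eta>_def R_def field_simps power2_eq_square)
    show "2 ^ k * 2 ^ l * cmod (bform A (\<xi> k) (\<eta> l)) \<le> C * 2 ^ k / 2 ^ l * (2 ^ l * norm (\<eta> l))\<^sup>2"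
      using cmod_bform_le_col_norm[of "\<xi> k" "\<eta> l" A] zero_one
      by (simp add: \<xi>_def \<eta>_def C_def field_simps power2_eq_square)
  next
    show "(\<Sum>k<M. (2 ^ k * norm (\<xi> k))\<^sup>2) \<le> (norm X)\<^sup>2"
      unfolding \<xi>_def X_def by (intro sum_norm_digit_vec_le M)
    show "(\<Sum>k<M. (2 ^ k * norm (\<eta> k))\<^sup>2) \<le> (norm Y)\<^sup>2"
      unfolding \<eta>_def Y_def by (intro sum_norm_digit_vec_le M)
  qed (use pos RC rayleigh_norm_nonneg in auto)
  also have "2 * R * 2 powr (- u) * (norm X)\<^sup>2 = N / 16 * (norm X * norm Y)"
    using pos RC by (simp add: powr power2_eq_square)
  also have "2 * C * 2 powr (- v) * (norm Y)\<^sup>2 = N / 16 * (norm X * norm Y)"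
    using pos RC by (simp add: powr power2_eq_square)
  finally show ?thesis unfolding uv by (simp add: algebra_simps)
qed auto

section \<open>From natural numbers to nonnegative real and then complex vectors\<close>

text \<open>Both sides scale alike in each argument, so the bound passes to the rational
  approximations \<open>\<lfloor>n * x\<rfloor> / n\<close>, and by continuity to their
  limits.\<close>

lemma cmod_bform_nonneg_real_le:
  fixes A :: "complex ^ 'n ^ 'm" and x :: "'m \<Rightarrow> real" and y :: "'n \<Rightarrow> real"
  assumes nat: "\<And>(x :: 'm \<Rightarrow> nat) (y :: 'n \<Rightarrow> nat).
      cmod (bform A (nat_vec x) (nat_vec y))
        \<le> K * (norm (nat_vec x) * norm (nat_vec y))"
    and x: "\<And>i. x i \<ge> 0" and y: "\<And>j. y j \<ge> 0"
  shows "cmod (bform A (real_vec x) (real_vec y))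
    \<le> K * (norm (real_vec x) * norm (real_vec y))"
proof -
  define a where "a = (\<lambda>n. (1 / of_nat n) *s (nat_vec (\<lambda>i. nat \<lfloor>real n * x i\<rfloor>)) :: complex ^ 'm)"
  define b where "b = (\<lambda>n. (1 / of_nat n) *s (nat_vec (\<lambda>j. nat \<lfloor>real n * y j\<rfloor>)) :: complex ^ 'n)"
  have scale: "norm (c *s w) = cmod c * norm w" for c and w :: "complex ^ 'k"
    by (simp add: norm_vec_def norm_mult L2_set_right_distrib)
  have floor: "(\<lambda>n. of_nat (nat \<lfloor>real n * r\<rfloor>) / of_nat n) \<longlonglongrightarrow> complex_of_real r" if "r \<ge> 0" for r
  proof -
    have "(\<lambda>n. real (nat \<lfloor>real n * r\<rfloor>) / real n) \<longlonglongrightarrow> r"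
    proof (rule tendsto_sandwich)
      show "(\<lambda>n. r - 1 / real n) \<longlonglongrightarrow> r" by real_asymp
      show "(\<lambda>n. r) \<longlonglongrightarrow> r" by simp
      show "\<forall>\<^sub>F n in sequentially. r - 1 / real n \<le> real (nat \<lfloor>real n * r\<rfloor>) / real n"
        using eventually_gt_at_top[of 0]
      proof eventually_elim
        case (elim n)
        have "real n * r - 1 \<le> real (nat \<lfloor>real n * r\<rfloor>)" by linarith
        then have "(real n * r - 1) / real n \<le> real (nat \<lfloor>real n * r\<rfloor>) / real n"
          by (rule divide_right_mono) simp
        with elim show ?case by (simp add: diff_divide_distrib)
      qed
      show "\<forall>\<^sub>F n in sequentially. real (nat \<lfloor>real n * r\<rfloor>) / real n \<le> r"
        using eventually_gt_at_top[of 0]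
      proof eventually_elim
        case (elim n)
        have "real (nat \<lfloor>real n * r\<rfloor>) \<le> real n * r" using that by (intro of_nat_floor) simp
        with elim show ?case by (simp add: field_simps)
      qed
    qed
    then have "(\<lambda>n. complex_of_real (real (nat \<lfloor>real n * r\<rfloor>) / real n)) \<longlonglongrightarrow> of_real r"
      by (rule tendsto_of_real)
    then show ?thesis by simp
  qed
  have a: "a \<longlonglongrightarrow> real_vec x"
    by (rule vec_tendstoI) (use floor[OF x] in \<open>simp add: a_def\<close>)
  have b: "b \<longlonglongrightarrow> real_vec y"
    by (rule vec_tendstoI) (use floor[OF y] in \<open>simp add: b_def\<close>)
  \<comment> \<open>This includes \<open>n = 0\<close>, where division by zero makes
    \<open>a n\<close> and \<open>b n\<close> zero vectors.\<close>
  have "cmod (bform A (a n) (b n)) \<le> K * (norm (a n) * norm (b n))" for n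
  proof -
    have "cmod (bform A (a n) (b n)) = 1 / real n * (1 / real n) *
        cmod (bform A (nat_vec (\<lambda>i. nat \<lfloor>real n * x i\<rfloor>)) (nat_vec (\<lambda>j. nat \<lfloor>real n * y j\<rfloor>)))"
      unfolding a_def b_def bform_scale by (simp add: norm_mult norm_divide)
    also have "\<dots> \<le> 1 / real n * (1 / real n) *
       (K * (norm (nat_vec (\<lambda>i. nat \<lfloor>real n * x i\<rfloor>)) * norm (nat_vec (\<lambda>j. nat \<lfloor>real n * y j\<rfloor>))))"
      by (intro mult_left_mono nat) simp
    also have "\<dots> = K * (norm (a n) * norm (b n))"
      unfolding a_def b_def scale by (simp add: norm_divide)
    finally show ?thesis .
  qed
  then show ?thesis
    by (intro tendsto_le[OF _ tendsto_mult[OF tendsto_const tendsto_mult[OF tendsto_norm[OF a] tendsto_norm[OF b]]]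
          tendsto_norm[OF tendsto_bform[OF a b]]]) auto
qed

text \<open>For \<open>k\<close> = 0, 1, 2, 3 these are the positive parts of Re, Im, -Re and -Im of
  each entry; multiplying by \<open>\<i> ^ k\<close> rotates a part back to its direction.\<close>

definition nonneg_part :: "complex ^ 'n \<Rightarrow> nat \<Rightarrow> 'n \<Rightarrow> real" where
  "nonneg_part u k i = max 0 (Re ((- \<i>) ^ k * u $ i))"

lemma sum_nonneg_part:
  "u = (\<Sum>k<4. \<i> ^ k *s (real_vec (nonneg_part u k)))"
  by (simp add: vec_eq_iff nonneg_part_def complex_eq_iff eval_nat_numeral max_def)

text \<open>At each entry the positive and negative part of a real number are never both non-zero,
  so the squares add up without cross terms.\<close>

lemma norm_nonneg_part_squares:
  "(\<Sum>k<4. (norm (real_vec (nonneg_part u k)))\<^sup>2) = (norm u)\<^sup>2"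
proof -
  have "(\<Sum>k<4. (nonneg_part u k i)\<^sup>2) = (cmod (u $ i))\<^sup>2" for i
    unfolding cmod_power2 by (simp add: nonneg_part_def eval_nat_numeral max_def)
  then show ?thesis
    unfolding L2_norm_squared_vec by (subst sum.swap) simp
qed

text \<open>Cauchy-Schwarz over the four parts gives the factor \<open>sqrt 4\<close>. Bounding each
  part by \<open>norm u\<close> would give 4, and 16 instead of 4 in the estimate of the
  form.\<close>

lemma sum_norm_nonneg_part_le:
  "(\<Sum>k<4. norm (real_vec (nonneg_part u k))) \<le> 2 * norm u"
proof (rule power2_le_imp_le)
  have "(\<Sum>k<4. norm (real_vec (nonneg_part u k)))\<^sup>2
      \<le> (\<Sum>k<4. (norm (real_vec (nonneg_part u k)))\<^sup>2) * card {..<4::nat}"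
    by (rule sum_squared_le_sum_of_squares)
  then show "(\<Sum>k<4. norm (real_vec (nonneg_part u k)))\<^sup>2 \<le> (2 * norm u)\<^sup>2"
    by (simp add: norm_nonneg_part_squares power_mult_distrib)
qed simp

lemma cmod_bform_le_of_nonneg:
  fixes A :: "complex ^ 'n ^ 'm"
  assumes nonneg: "\<And>(x :: 'm \<Rightarrow> real) (y :: 'n \<Rightarrow> real). (\<And>i. x i \<ge> 0) \<Longrightarrow> (\<And>j. y j \<ge> 0) \<Longrightarrow>
      cmod (bform A (real_vec x) (real_vec y))
        \<le> K * (norm (real_vec x) * norm (real_vec y))"
    and "K \<ge> 0"
  shows "cmod (bform A u v) \<le> 4 * K * norm u * norm v"
proof -
  define a where "a k = real_vec (nonneg_part u k)" for k
  define b where "b k = real_vec (nonneg_part v k)" for k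
  have "bform A u v = (\<Sum>k<4. \<Sum>l<4. \<i> ^ k * \<i> ^ l * bform A (a k) (b l))"
    by (subst sum_nonneg_part[of u], subst sum_nonneg_part[of v])
      (simp only: a_def b_def bform_sum bform_scale)
  also have "cmod \<dots> \<le> (\<Sum>k<4. \<Sum>l<4. K * (norm (a k) * norm (b l)))"
  proof (intro sum_norm_le)
    fix k l
    have "cmod (bform A (a k) (b l)) \<le> K * (norm (a k) * norm (b l))"
      unfolding a_def b_def by (rule nonneg) (auto simp: nonneg_part_def)
    then show "cmod (\<i> ^ k * \<i> ^ l * bform A (a k) (b l)) \<le> K * (norm (a k) * norm (b l))"
      by (simp add: norm_mult norm_power)
  qed
  also have "\<dots> = K * ((\<Sum>k<4. norm (a k)) * (\<Sum>l<4. norm (b l)))"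
    unfolding sum_product by (simp only: sum_distrib_left)
  also have "\<dots> \<le> K * ((2 * norm u) * (2 * norm v))"
    unfolding a_def b_def using \<open>K \<ge> 0\<close>
    by (intro mult_left_mono mult_mono sum_norm_nonneg_part_le sum_nonneg) auto
  finally show ?thesis by (simp add: mult_ac)
qed

section \<open>Absorbing the tails and comparing constants\<close>

lemma op_norm_le_rayleigh_norm:
  assumes "A \<noteq> 0"
  shows "op_norm A \<le> 8 * rayleigh_norm A * max 0 (11 + 2 * log 2 (height A))"
proof -
  define K where "K = rayleigh_norm A * max 0 (11 + 2 * log 2 (height A)) + op_norm A / 8"
  have "K \<ge> 0"
    unfolding K_def by (intro add_nonneg_nonneg mult_nonneg_nonneg rayleigh_norm_nonneg) (auto simp: op_norm_nonneg)
  then have "op_norm A \<le> 4 * K"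
    by (intro op_norm_le cmod_bform_le_of_nonneg cmod_bform_nonneg_real_le
        cmod_bform_nat_le[OF assms, folded K_def])
  \<comment> \<open>The tail term of \<open>4 * K\<close> is half of \<open>op_norm A\<close>;
    moving it to the left doubles the factor 4 to 8.\<close>
  then show ?thesis unfolding K_def by simp
qed

theorem theorem2:
  fixes A :: "complex ^ 'n ^ 'm"
  assumes "A \<noteq> 0"
  shows "op_norm A / (32 * sqrt 2 * (ln (height A) + 4)) \<le> rayleigh_norm A
         \<and> rayleigh_norm A \<le> op_norm A"
proof
  define L where "L = 11 + 2 * log 2 (height A)"
  have N: "0 < op_norm A" "op_norm A \<le> 8 * rayleigh_norm A * max 0 L"
    using assms by (auto simp: L_def op_norm_pos op_norm_le_rayleigh_norm)
  \<comment> \<open>Otherwise \<open>max 0 L\<close> is 0 and \<open>op_norm A\<close> could not be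
    positive; this takes the place of a separate lower bound for the height.\<close>
  then have "L > 0" by (cases "L > 0") (auto simp: max_def split: if_splits)
  have ln2: "2 / 3 \<le> ln (2 :: real)" "ln (2 :: real) \<le> 25 / 36"
    by (rule ln2_ge_two_thirds ln2_le_25_over_36)+
  \<comment> \<open>The remainder is nonnegative because \<open>11 / 2 * ln 2\<close> is at most 275
    / 72, which is less than 4; the bound \<open>2 / 3 \<le> ln 2\<close> then leaves
    \<open>L / 3\<close>.\<close>
  have "ln (height A) + 4 = ln 2 * L / 2 + (4 - 11 / 2 * ln 2)"
    by (simp add: L_def log_def field_simps)
  moreover have "2 / 3 * L \<le> ln 2 * L" using ln2 \<open>L > 0\<close> by (intro mult_right_mono) auto
  ultimately have lower: "L / 3 \<le> ln (height A) + 4" using ln2 by linarith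
  \<comment> \<open>This crude bound is enough, as 32 / 3 already exceeds the factor 8 of the
    preceding estimate.\<close>
  have "1 \<le> sqrt 2" by simp
  then have "32 * 1 * (L / 3) \<le> 32 * sqrt 2 * (ln (height A) + 4)"
    using lower \<open>L > 0\<close> by (intro mult_mono) auto
  then have "8 * L \<le> 32 * sqrt 2 * (ln (height A) + 4)" using \<open>L > 0\<close> by linarith
  then have "rayleigh_norm A * (8 * L) \<le> rayleigh_norm A * (32 * sqrt 2 * (ln (height A) + 4))"
    by (intro mult_left_mono rayleigh_norm_nonneg)
  then show "op_norm A / (32 * sqrt 2 * (ln (height A) + 4)) \<le> rayleigh_norm A"
    using N lower \<open>L > 0\<close> by (subst pos_divide_le_eq) (auto simp: mult_ac)
  show "rayleigh_norm A \<le> op_norm A" by (rule rayleigh_norm_le_op_norm)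
qed

end
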